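(* Let $r\in\mathbb{R}$, $\sigma\ge 0$, $T>0$, let $S(t)=e^{(r-\sigma^2/2)t+\sigma B(t)}$ for $t\ge 0$, where $B$ is a standard Brownian motion, and let $A(T)=\frac1T\int_0^T S(t)\,dt$. Then $$\mathbb{E}\left(S(T)A(T)\right)=\exp[rT,\,(2r+\sigma^2)T].$$
   Context: $B:[0,\infty)\to\mathbb{R}$ is standard Brownian motion: $B(0)=0$, increments are independent, and for $0\le s<t$ the increment $B(t)-B(s)$ is normal with mean $0$ and variance $t-s$ (with continuous paths). For a function $f$ and points $a_0,\dots,a_n$, the divided difference $f[a_0,\dots,a_n]$ is the coefficient of $x^n$ in the unique polynomial of degree at most $n$ interpolating $f$ at $a_0,\dots,a_n$. If points coincide and $f$ is sufficiently differentiable, interpolation is understood in the Hermite sense (matching derivatives up to multiplicity minus one). $\exp[a_0,\dots,a_n]$ denotes the divided difference of the exponential function. *)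

theory Defs
  imports "HOL-Probability.Probability" "HOL-Computational_Algebra.Polynomial"
begin

text \<open>The time index ranges over all of \<open>real\<close>, but only the values at times \<open>t \<ge> 0\<close> are constrained.\<close>

locale std_brownian_motion = prob_space M
  for M :: "'a measure" +
  fixes B :: "real \<Rightarrow> 'a \<Rightarrow> real"
  assumes random_variable_B: "0 \<le> t \<Longrightarrow> random_variable borel (B t)"
    and start: "\<omega> \<in> space M \<Longrightarrow> B 0 \<omega> = 0"
    and indep_increments:
      "\<lbrakk>0 \<le> \<tau> 0; strict_mono_on {..n} \<tau>\<rbrakk> \<Longrightarrow>
        indep_vars (\<lambda>_. borel) (\<lambda>i \<omega>. B (\<tau> (Suc i)) \<omega> - B (\<tau> i) \<omega>) {..<n}"
    and normal_increments:
      "\<lbrakk>0 \<le> s; s < t\<rbrakk> \<Longrightarrow>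
        distributed M lborel (\<lambda>\<omega>. B t \<omega> - B s \<omega>) (normal_density 0 (sqrt (t - s)))"
    and continuous_paths: "\<omega> \<in> space M \<Longrightarrow> continuous_on {0..} (\<lambda>t. B t \<omega>)"

definition geometric_bm ::
    "real \<Rightarrow> real \<Rightarrow> (real \<Rightarrow> 'a \<Rightarrow> real) \<Rightarrow> real \<Rightarrow> 'a \<Rightarrow> real" where
  "geometric_bm r \<sigma> B t \<omega> = exp ((r - \<sigma>\<^sup>2 / 2) * t + \<sigma> * B t \<omega>)"

definition time_average :: "(real \<Rightarrow> 'a \<Rightarrow> real) \<Rightarrow> real \<Rightarrow> 'a \<Rightarrow> real" where
  "time_average S T \<omega> = 1 / T * (LINT t:{0..T}|lborel. S t \<omega>)"

text \<open>
  The nodes \<open>a\<^sub>0, \<dots>, a\<^sub>n\<close> form a nonempty list of length \<open>n + 1\<close>. At a node of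
  multiplicity \<open>m\<close> the derivatives of orders \<open>0, \<dots>, m - 1\<close> are matched; for distinct
  nodes this is ordinary interpolation.
\<close>

definition hermite_interpolates :: "(real \<Rightarrow> real) \<Rightarrow> real list \<Rightarrow> real poly \<Rightarrow> bool" where
  "hermite_interpolates f as p \<longleftrightarrow>
    degree p \<le> length as - 1 \<and>
    (\<forall>a\<in>set as. \<forall>k<count_list as a. poly ((pderiv ^^ k) p) a = (deriv ^^ k) f a)"

definition divided_difference :: "(real \<Rightarrow> real) \<Rightarrow> real list \<Rightarrow> real" where
  "divided_difference f as = coeff (THE p. hermite_interpolates f as p) (length as - 1)"

end

theory Submission
  imports Defs
begin

text \<open>
  The product of the price and its average is an average of products,
  \<open>S(T) A(T) = 1/T \<integral>\<^sub>0\<^sup>T S(T) S(t) dt\<close>. All factors are positive, so Tonelli's theorem moves the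
  expectation inside the time integral once \<open>B\<close> is known to be jointly measurable in time and
  outcome (\<open>measurable_process_pair\<close>).

  For \<open>0 < t < T\<close> the exponent of \<open>S(T) S(t)\<close> contains \<open>B(T) + B(t) = 2 B(t) + (B(T) - B(t))\<close>, a
  combination of two independent centred normal variables of variances \<open>t\<close> and \<open>T - t\<close>. The
  normal moment generating function gives \<open>E(S(T) S(t)) = exp (r T + (r + \<sigma>\<^sup>2) t)\<close>
  (\<open>nn_integral_gbm_product\<close>).

  As \<open>t\<close> runs through \<open>[0, T]\<close>, the exponent \<open>r T + (r + \<sigma>\<^sup>2) t\<close> moves linearly from \<open>r T\<close> to
  \<open>(2 r + \<sigma>\<^sup>2) T\<close>. The mean of \<open>exp = exp'\<close> over the segment between two nodes is the first-order
  divided difference at these nodes, also when the nodes coincide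
  (\<open>nn_integral_exp_segment\<close>, the first-order case of the Hermite--Genocchi formula).
\<close>

section \<open>First-order divided differences\<close>

lemma divided_difference_eqI:
  assumes "hermite_interpolates f [a, b] [:c, d:]"
    and "\<And>p. hermite_interpolates f [a, b] p \<Longrightarrow> p = [:c, d:]"
  shows "divided_difference f [a, b] = d"
proof -
  have "(THE p. hermite_interpolates f [a, b] p) = [:c, d:]"
    using assms by (rule the_equality)
  then show ?thesis
    by (simp add: divided_difference_def)
qed

lemma hermite_interpolates_two_linear:
  assumes "hermite_interpolates f [a, b] p"
  obtains c d where "p = [:c, d:]"
proof
  have "degree p \<le> 1"
    using assms by (simp add: hermite_interpolates_def)
  then show "p = [:coeff p 0, coeff p 1:]"
    by (auto intro!: poly_eqI simp: coeff_pCons coeff_eq_0 split: nat.splits)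
qed

lemma divided_difference_distinct:
  fixes a b :: real
  assumes "a \<noteq> b"
  shows "divided_difference f [a, b] = (f b - f a) / (b - a)"
proof (rule divided_difference_eqI)
  define d where "d = (f b - f a) / (b - a)"
  then have d: "d * (b - a) = f b - f a"
    using assms by simp
  have iff: "hermite_interpolates f [a, b] [:c, d:] \<longleftrightarrow> c + a * d = f a \<and> c + b * d = f b" for c d
    using assms by (auto simp: hermite_interpolates_def)
  show "hermite_interpolates f [a, b] [:f a - a * ((f b - f a) / (b - a)), (f b - f a) / (b - a):]"
    using d by (simp add: iff d_def[symmetric] algebra_simps)
  fix p assume p: "hermite_interpolates f [a, b] p"
  then obtain c e where ce: "p = [:c, e:]"
    by (rule hermite_interpolates_two_linear)
  with p have eqs: "c + a * e = f a" "c + b * e = f b"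
    by (simp_all add: iff)
  then have "e * (b - a) = d * (b - a)"
    unfolding d by (simp add: algebra_simps)
  then have "e = d"
    using assms by simp
  with eqs ce show "p = [:f a - a * ((f b - f a) / (b - a)), (f b - f a) / (b - a):]"
    by (simp add: d_def[symmetric])
qed

lemma divided_difference_coincident:
  "divided_difference f [a, a] = deriv f a"
proof (rule divided_difference_eqI)
  have iff: "hermite_interpolates f [a, a] [:c, d:] \<longleftrightarrow> c + a * d = f a \<and> d = deriv f a" for c d
    by (auto simp: hermite_interpolates_def less_Suc_eq numeral_2_eq_2 pderiv_pCons)
  show "hermite_interpolates f [a, a] [:f a - a * deriv f a, deriv f a:]"
    by (simp add: iff)
  fix p assume p: "hermite_interpolates f [a, a] p"
  then obtain c d where "p = [:c, d:]"
    by (rule hermite_interpolates_two_linear)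
  with p show "p = [:f a - a * deriv f a, deriv f a:]"
    by (auto simp: iff)
qed

lemma divided_difference_exp_coincident: "divided_difference exp [a, a] = exp a"
  by (simp add: divided_difference_coincident DERIV_imp_deriv[OF DERIV_exp])

lemma divided_difference_exp_nonneg: "0 \<le> divided_difference exp [a, b]"
proof (cases "a = b")
  case False
  then show ?thesis
    by (auto simp: divided_difference_distinct zero_le_divide_iff)
qed (simp add: divided_difference_exp_coincident)

text \<open>
  For \<open>d \<noteq> 0\<close> the antiderivative \<open>exp (c + d t) / d\<close> produces the difference quotient; for \<open>d = 0\<close>
  the integrand is constant and the confluent divided difference is the derivative of \<open>exp\<close>.
\<close>

lemma nn_integral_exp_segment:
  fixes c d T :: real
  assumes "0 < T"
  shows "(\<integral>\<^sup>+ t. ennreal (exp (c + d * t)) * indicator {0..T} t \<partial>lborel)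
       = ennreal (T * divided_difference exp [c, c + d * T])"
proof (cases "d = 0")
  case True
  with True assms show ?thesis
    by (simp add: divided_difference_exp_coincident nn_integral_cmult ennreal_mult' mult.commute)
next
  case False
  have "(\<integral>\<^sup>+ t. ennreal (exp (c + d * t)) * indicator {0..T} t \<partial>lborel)
      = ennreal (exp (c + d * T) / d - exp (c + d * 0) / d)"
    using assms False
    by (intro nn_integral_FTC_Icc) (auto intro!: derivative_eq_intros)
  also have "exp (c + d * T) / d - exp (c + d * 0) / d = T * divided_difference exp [c, c + d * T]"
    using assms False by (simp add: divided_difference_distinct field_simps)
  finally show ?thesis .
qed

section \<open>Exponential moments of Brownian motion\<close>

text \<open>
  Completing the square turns \<open>exp (c x)\<close> times the density into a constant times the normal
  density with mean \<open>c s\<^sup>2\<close>.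
\<close>

lemma nn_integral_exp_normal:
  fixes c s :: real
  assumes "distributed M lborel X (normal_density 0 s)" and s: "0 < s"
  shows "(\<integral>\<^sup>+ \<omega>. ennreal (exp (c * X \<omega>)) \<partial>M) = ennreal (exp (c\<^sup>2 * s\<^sup>2 / 2))"
proof -
  have square: "normal_density 0 s x * exp (c * x)
      = exp (c\<^sup>2 * s\<^sup>2 / 2) * normal_density (c * s\<^sup>2) s x" for x
  proof -
    have "- x\<^sup>2 / (2 * s\<^sup>2) + c * x = c\<^sup>2 * s\<^sup>2 / 2 + - (x - c * s\<^sup>2)\<^sup>2 / (2 * s\<^sup>2)"
      using s by (simp add: field_simps power2_eq_square)
    then have "exp (- x\<^sup>2 / (2 * s\<^sup>2)) * exp (c * x)
        = exp (c\<^sup>2 * s\<^sup>2 / 2) * exp (- (x - c * s\<^sup>2)\<^sup>2 / (2 * s\<^sup>2))"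
      by (simp only: exp_add[symmetric])
    then show ?thesis
      by (simp add: normal_density_def)
  qed
  have "(\<integral>\<^sup>+ \<omega>. ennreal (exp (c * X \<omega>)) \<partial>M)
      = (\<integral>\<^sup>+ x. ennreal (normal_density 0 s x) * ennreal (exp (c * x)) \<partial>lborel)"
    using assms(1) by (subst distributed_nn_integral) auto
  also have "\<dots> = (\<integral>\<^sup>+ x. ennreal (exp (c\<^sup>2 * s\<^sup>2 / 2)) * ennreal (normal_density (c * s\<^sup>2) s x) \<partial>lborel)"
    by (simp add: ennreal_mult[symmetric] square)
  also have "\<dots> = ennreal (exp (c\<^sup>2 * s\<^sup>2 / 2)) * (\<integral>\<^sup>+ x. ennreal (normal_density (c * s\<^sup>2) s x) \<partial>lborel)"
    by (rule nn_integral_cmult) simp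
  also have "(\<integral>\<^sup>+ x. ennreal (normal_density (c * s\<^sup>2) s x) \<partial>lborel) = 1"
    using s by (simp add: nn_integral_eq_integral)
  finally show ?thesis
    by simp
qed

text \<open>
  Since \<open>B 0 = 0\<close>, the value \<open>B s\<close> is itself the increment over \<open>[0, s]\<close> and hence independent of
  \<open>B t - B s\<close>.
\<close>

lemma (in std_brownian_motion) nn_integral_exp_two_increments:
  assumes "0 < s" "s < t"
  shows "(\<integral>\<^sup>+ \<omega>. ennreal (exp (a * B s \<omega> + b * (B t \<omega> - B s \<omega>))) \<partial>M)
       = ennreal (exp ((a\<^sup>2 * s + b\<^sup>2 * (t - s)) / 2))"
proof -
  define \<tau> :: "nat \<Rightarrow> real" where "\<tau> i = (if i = 0 then 0 else if i = 1 then s else t)" for i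
  define c :: "nat \<Rightarrow> real" where "c i = (if i = 0 then a else b)" for i
  define D where "D i \<omega> = B (\<tau> (Suc i)) \<omega> - B (\<tau> i) \<omega>" for i \<omega>
  have "strict_mono_on {..2} \<tau>"
    using assms by (auto simp: strict_mono_on_def \<tau>_def)
  then have "indep_vars (\<lambda>_. borel) D {..<2}"
    unfolding D_def by (intro indep_increments) (simp add: \<tau>_def)
  then have indep: "indep_vars (\<lambda>_. borel) (\<lambda>i \<omega>. ennreal (exp (c i * D i \<omega>))) {..<2}"
    by (rule indep_vars_compose2) simp
  have moment: "(\<integral>\<^sup>+ \<omega>. ennreal (exp (d * (B v \<omega> - B u \<omega>))) \<partial>M) = ennreal (exp (d\<^sup>2 * (v - u) / 2))"
    if "0 \<le> u" "u < v" for d u v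
    using nn_integral_exp_normal[OF normal_increments[OF that], of d] that by simp
  have "(\<integral>\<^sup>+ \<omega>. ennreal (exp (a * B s \<omega> + b * (B t \<omega> - B s \<omega>))) \<partial>M)
      = (\<integral>\<^sup>+ \<omega>. (\<Prod>i<2. ennreal (exp (c i * D i \<omega>))) \<partial>M)"
    by (intro nn_integral_cong)
      (simp add: numeral_2_eq_2 c_def D_def \<tau>_def start exp_add ennreal_mult)
  also have "\<dots> = (\<Prod>i<2. \<integral>\<^sup>+ \<omega>. ennreal (exp (c i * D i \<omega>)) \<partial>M)"
    using indep by (intro indep_vars_nn_integral) auto
  also have "\<dots> = ennreal (exp (a\<^sup>2 * s / 2)) * ennreal (exp (b\<^sup>2 * (t - s) / 2))"
    using assms moment[of 0 s a] moment[of s t b]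
    by (simp add: numeral_2_eq_2 c_def D_def \<tau>_def)
  also have "\<dots> = ennreal (exp ((a\<^sup>2 * s + b\<^sup>2 * (t - s)) / 2))"
    by (simp add: ennreal_mult[symmetric] exp_add[symmetric] add_divide_distrib)
  finally show ?thesis .
qed

lemma (in std_brownian_motion) nn_integral_gbm_product:
  assumes "0 < t" "t < T"
  shows "(\<integral>\<^sup>+ \<omega>. ennreal (geometric_bm r \<sigma> B T \<omega> * geometric_bm r \<sigma> B t \<omega>) \<partial>M)
       = ennreal (exp (r * T + (r + \<sigma>\<^sup>2) * t))"
proof -
  let ?m = "(r - \<sigma>\<^sup>2 / 2) * (T + t)"
  have "(\<integral>\<^sup>+ \<omega>. ennreal (geometric_bm r \<sigma> B T \<omega> * geometric_bm r \<sigma> B t \<omega>) \<partial>M)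
      = (\<integral>\<^sup>+ \<omega>. ennreal (exp ?m) * ennreal (exp (2 * \<sigma> * B t \<omega> + \<sigma> * (B T \<omega> - B t \<omega>))) \<partial>M)"
  proof (intro nn_integral_cong)
    fix \<omega>
    have "((r - \<sigma>\<^sup>2 / 2) * T + \<sigma> * B T \<omega>) + ((r - \<sigma>\<^sup>2 / 2) * t + \<sigma> * B t \<omega>)
        = ?m + (2 * \<sigma> * B t \<omega> + \<sigma> * (B T \<omega> - B t \<omega>))"
      by (simp add: algebra_simps)
    then show "ennreal (geometric_bm r \<sigma> B T \<omega> * geometric_bm r \<sigma> B t \<omega>)
        = ennreal (exp ?m) * ennreal (exp (2 * \<sigma> * B t \<omega> + \<sigma> * (B T \<omega> - B t \<omega>)))"
      by (simp only: geometric_bm_def ennreal_mult[symmetric] exp_ge_zero exp_add[symmetric])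
  qed
  also have "\<dots> = ennreal (exp ?m) * ennreal (exp (((2 * \<sigma>)\<^sup>2 * t + \<sigma>\<^sup>2 * (T - t)) / 2))"
  proof (subst nn_integral_cmult)
    have [measurable]: "B t \<in> borel_measurable M" "B T \<in> borel_measurable M"
      using assms by (auto intro: random_variable_B)
    show "(\<lambda>\<omega>. ennreal (exp (2 * \<sigma> * B t \<omega> + \<sigma> * (B T \<omega> - B t \<omega>)))) \<in> borel_measurable M"
      by measurable
  qed (simp only: nn_integral_exp_two_increments[OF assms])
  also have "\<dots> = ennreal (exp (r * T + (r + \<sigma>\<^sup>2) * t))"
  proof -
    have "?m + ((2 * \<sigma>)\<^sup>2 * t + \<sigma>\<^sup>2 * (T - t)) / 2 = r * T + (r + \<sigma>\<^sup>2) * t"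
      by (simp add: field_simps power2_eq_square)
    then show ?thesis
      by (simp only: ennreal_mult[symmetric] exp_ge_zero exp_add[symmetric])
  qed
  finally show ?thesis .
qed

section \<open>Joint measurability and the exchange of integrals\<close>

text \<open>
  A process with continuous paths is the limit of its piecewise constant interpolations on the
  ever finer grids, and these are jointly measurable because they involve countably many times
  only. The time is clipped to \<open>max 0 t\<close> because nothing is known about \<open>X\<close> at negative times.
\<close>

lemma measurable_process_pair:
  fixes X :: "real \<Rightarrow> 'a \<Rightarrow> real"
  assumes X: "\<And>t. 0 \<le> t \<Longrightarrow> X t \<in> borel_measurable M"
    and cont: "\<And>\<omega>. \<omega> \<in> space M \<Longrightarrow> continuous_on {0..} (\<lambda>t. X t \<omega>)"
  shows "(\<lambda>(t, \<omega>). X (max 0 t) \<omega>) \<in> borel_measurable (lborel \<Otimes>\<^sub>M M)"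
proof (rule borel_measurable_LIMSEQ_real)
  define g :: "nat \<Rightarrow> real \<Rightarrow> real"
    where "g n t = real_of_int \<lfloor>real (Suc n) * max 0 t\<rfloor> / real (Suc n)" for n t
  have g_nonneg: "0 \<le> g n t" for n t
    by (simp add: g_def)
  have g_lim: "(\<lambda>n. g n t) \<longlonglongrightarrow> max 0 t" for t
  proof (rule tendsto_sandwich[of "\<lambda>n. max 0 t - 1 / real (Suc n)" _ _ "\<lambda>_. max 0 t"])
    have "max 0 t - 1 / real (Suc n) \<le> g n t \<and> g n t \<le> max 0 t" for n
    proof -
      define y where "y = real (Suc n) * max 0 t"
      have "(y - 1) / real (Suc n) \<le> of_int \<lfloor>y\<rfloor> / real (Suc n)"
        and "of_int \<lfloor>y\<rfloor> / real (Suc n) \<le> y / real (Suc n)"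
        by (intro divide_right_mono; linarith)+
      moreover have "y / real (Suc n) = max 0 t"
        by (simp add: y_def del: of_nat_Suc)
      ultimately show ?thesis
        by (simp add: g_def y_def diff_divide_distrib del: of_nat_Suc)
    qed
    then show "\<forall>\<^sub>F n in sequentially. max 0 t - 1 / real (Suc n) \<le> g n t"
      and "\<forall>\<^sub>F n in sequentially. g n t \<le> max 0 t"
      by simp_all
    have "(\<lambda>n. 1 / real (Suc n)) \<longlonglongrightarrow> 0"
      by (rule LIMSEQ_Suc[OF lim_1_over_n])
    from tendsto_diff[OF tendsto_const this, of "max 0 t"]
    show "(\<lambda>n. max 0 t - 1 / real (Suc n)) \<longlonglongrightarrow> max 0 t"
      by simp
  qed simp
  show "(\<lambda>n. case x of (t, \<omega>) \<Rightarrow> X (g n t) \<omega>) \<longlonglongrightarrow> (case x of (t, \<omega>) \<Rightarrow> X (max 0 t) \<omega>)"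
    if x_in: "x \<in> space (lborel \<Otimes>\<^sub>M M)" for x
  proof -
    obtain t \<omega> where x: "x = (t, \<omega>)" "\<omega> \<in> space M"
      using x_in by (cases x) (auto simp: space_pair_measure)
    have "(\<lambda>n. X (g n t) \<omega>) \<longlonglongrightarrow> X (max 0 t) \<omega>"
      by (rule continuous_on_tendsto_compose[OF cont[OF x(2)] g_lim]) (auto simp: g_nonneg)
    with x show ?thesis by simp
  qed
  show "(\<lambda>(t, \<omega>). X (g n t) \<omega>) \<in> borel_measurable (lborel \<Otimes>\<^sub>M M)" for n
  proof -
    let ?X = "\<lambda>k (x :: real \<times> 'a). X (max 0 (real_of_int k / real (Suc n))) (snd x)"
    let ?k = "\<lambda>x. \<lfloor>real (Suc n) * max 0 (fst x)\<rfloor>"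
    have "(\<lambda>x. ?X (?k x) x) \<in> borel_measurable (lborel \<Otimes>\<^sub>M M)"
    proof (rule measurable_compose_countable[where f = ?X and g = ?k])
      show "?X k \<in> borel_measurable (lborel \<Otimes>\<^sub>M M)" for k
        by (rule measurable_compose[OF measurable_snd X]) simp
      show "?k \<in> measurable (lborel \<Otimes>\<^sub>M M) (count_space UNIV)"
        by measurable
    qed
    moreover have "(\<lambda>x. ?X (?k x) x) = (\<lambda>(t, \<omega>). X (g n t) \<omega>)"
      by (auto simp: fun_eq_iff g_def max_def)
    ultimately show ?thesis by simp
  qed
qed

text \<open>
  The bridge from the Bochner integral in the time average to the nonnegative integral that
  Tonelli's theorem exchanges with the expectation.
\<close>

lemma nn_integral_mult_time_average:
  assumes "0 < T" and "0 \<le> x"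
    and cont: "continuous_on {0..T} (\<lambda>t. S t \<omega>)"
    and nonneg: "\<And>t. t \<in> {0..T} \<Longrightarrow> 0 \<le> S t \<omega>"
  shows "ennreal (x * time_average S T \<omega>)
       = (\<integral>\<^sup>+ t. ennreal (1 / T) * (ennreal (x * S t \<omega>) * indicator {0..T} t) \<partial>lborel)"
proof -
  let ?f = "\<lambda>t. x / T * (indicator {0..T} t * S t \<omega>)"
  have "integrable lborel (\<lambda>t. indicator {0..T} t *\<^sub>R S t \<omega>)"
    using borel_integrable_atLeastAtMost'[OF cont] by (simp add: set_integrable_def)
  then have int: "integrable lborel ?f"
    by simp
  have "x * time_average S T \<omega> = (\<integral>t. ?f t \<partial>lborel)"
    by (simp add: time_average_def set_lebesgue_integral_def)
  also have "ennreal \<dots> = (\<integral>\<^sup>+ t. ennreal (?f t) \<partial>lborel)"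
    using assms by (intro nn_integral_eq_integral[symmetric] int AE_I2) (auto simp: indicator_def)
  also have "\<dots> = (\<integral>\<^sup>+ t. ennreal (1 / T) * (ennreal (x * S t \<omega>) * indicator {0..T} t) \<partial>lborel)"
    using assms by (intro nn_integral_cong) (auto simp: indicator_def ennreal_mult[symmetric])
  finally show ?thesis .
qed

theorem proposition2p3:
  fixes M :: "'a measure" and B :: "real \<Rightarrow> 'a \<Rightarrow> real" and r \<sigma> T :: real
  assumes "std_brownian_motion M B"
    and "\<sigma> \<ge> 0" and "T > 0"
  shows "prob_space.expectation M
           (\<lambda>\<omega>. geometric_bm r \<sigma> B T \<omega> * time_average (geometric_bm r \<sigma> B) T \<omega>)
         = divided_difference exp [r * T, (2 * r + \<sigma>\<^sup>2) * T]"
proof -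
  interpret std_brownian_motion M B by fact
  interpret pair_sigma_finite lborel M ..
  let ?S = "geometric_bm r \<sigma> B"
  let ?Z = "\<lambda>\<omega>. ?S T \<omega> * time_average ?S T \<omega>"
  let ?V = "divided_difference exp [r * T, (2 * r + \<sigma>\<^sup>2) * T]"
  define H where "H t \<omega> = ennreal (1 / T) * (ennreal (?S T \<omega> * ?S (max 0 t) \<omega>) * indicator {0..T} t)"
    for t \<omega>
  have B_T [measurable]: "B T \<in> borel_measurable M"
    using assms by (intro random_variable_B) simp
  have B_pair [measurable]: "(\<lambda>(t, \<omega>). B (max 0 t) \<omega>) \<in> borel_measurable (lborel \<Otimes>\<^sub>M M)"
    by (intro measurable_process_pair random_variable_B continuous_paths)
  have S_pair: "(\<lambda>(t, \<omega>). ?S (max 0 t) \<omega>) \<in> borel_measurable (lborel \<Otimes>\<^sub>M M)"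
    unfolding geometric_bm_def by measurable
  have S_T [measurable]: "?S T \<in> borel_measurable M"
    unfolding geometric_bm_def by measurable
  have H_meas: "case_prod H \<in> borel_measurable (lborel \<Otimes>\<^sub>M M)"
    unfolding H_def using S_pair by measurable
  have Z_nn: "ennreal (?Z \<omega>) = (\<integral>\<^sup>+ t. H t \<omega> \<partial>lborel)" if "\<omega> \<in> space M" for \<omega>
  proof -
    have "continuous_on {0..T} (\<lambda>t. ?S t \<omega>)"
      unfolding geometric_bm_def
      by (intro continuous_intros continuous_on_subset[OF continuous_paths[OF that]]) auto
    then have "ennreal (?Z \<omega>)
        = (\<integral>\<^sup>+ t. ennreal (1 / T) * (ennreal (?S T \<omega> * ?S t \<omega>) * indicator {0..T} t) \<partial>lborel)"
      using assms by (intro nn_integral_mult_time_average) (auto simp: geometric_bm_def)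
    also have "\<dots> = (\<integral>\<^sup>+ t. H t \<omega> \<partial>lborel)"
      by (intro nn_integral_cong) (auto simp: H_def indicator_def)
    finally show ?thesis .
  qed
  have Z_nonneg: "0 \<le> ?Z \<omega>" for \<omega>
    using assms
    by (auto simp: geometric_bm_def time_average_def set_lebesgue_integral_def
        intro!: mult_nonneg_nonneg integral_nonneg)
  have Z_meas: "?Z \<in> borel_measurable M"
  proof -
    have [measurable]: "(\<lambda>(\<omega>, t). H t \<omega>) \<in> borel_measurable (M \<Otimes>\<^sub>M lborel)"
      using measurable_pair_swap[OF H_meas] by simp
    have "(\<lambda>\<omega>. enn2real (\<integral>\<^sup>+ t. H t \<omega> \<partial>lborel)) \<in> borel_measurable M"
      by measurable
    then show ?thesis
      by (rule measurable_cong[THEN iffD1, rotated]) (simp flip: Z_nn add: Z_nonneg)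
  qed
  \<comment> \<open>The two end points of the time interval, where one of the increments degenerates, form a
    null set.\<close>
  have expectation_H: "AE t in lborel. (\<integral>\<^sup>+ \<omega>. H t \<omega> \<partial>M)
      = ennreal (1 / T) * (ennreal (exp (r * T + (r + \<sigma>\<^sup>2) * t)) * indicator {0..T} t)"
    using AE_lborel_singleton[of 0] AE_lborel_singleton[of T]
  proof eventually_elim
    case (elim t)
    show ?case
    proof (cases "t \<in> {0..T}")
      case True
      with elim have t: "0 < t" "t < T" by auto
      have [measurable]: "B t \<in> borel_measurable M"
        using t by (intro random_variable_B) simp
      have [measurable]: "?S t \<in> borel_measurable M"
        unfolding geometric_bm_def by measurable
      have "(\<integral>\<^sup>+ \<omega>. H t \<omega> \<partial>M) = ennreal (1 / T) * (\<integral>\<^sup>+ \<omega>. ennreal (?S T \<omega> * ?S t \<omega>) \<partial>M)"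
        using t by (simp add: H_def nn_integral_cmult)
      with t show ?thesis
        by (simp add: nn_integral_gbm_product)
    qed (simp add: H_def)
  qed
  have "(\<integral>\<^sup>+ \<omega>. ennreal (?Z \<omega>) \<partial>M) = (\<integral>\<^sup>+ \<omega>. (\<integral>\<^sup>+ t. H t \<omega> \<partial>lborel) \<partial>M)"
    by (intro nn_integral_cong Z_nn)
  also have "\<dots> = (\<integral>\<^sup>+ t. (\<integral>\<^sup>+ \<omega>. H t \<omega> \<partial>M) \<partial>lborel)"
    by (rule Fubini'[OF H_meas])
  also have "\<dots> = (\<integral>\<^sup>+ t. ennreal (1 / T)
      * (ennreal (exp (r * T + (r + \<sigma>\<^sup>2) * t)) * indicator {0..T} t) \<partial>lborel)"
    by (rule nn_integral_cong_AE[OF expectation_H])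
  also have "\<dots> = ennreal (1 / T) * ennreal (T * divided_difference exp [r * T, r * T + (r + \<sigma>\<^sup>2) * T])"
    using assms by (simp add: nn_integral_cmult nn_integral_exp_segment)
  also have "\<dots> = ennreal ?V"
    using assms by (simp add: ennreal_mult'[symmetric] algebra_simps)
  finally have "(\<integral>\<^sup>+ \<omega>. ennreal (?Z \<omega>) \<partial>M) = ennreal ?V" .
  moreover have "0 \<le> ?V"
    by (rule divided_difference_exp_nonneg)
  ultimately show ?thesis
    using Z_meas Z_nonneg by (simp add: integral_eq_nn_integral)
qed

end
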